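(* Let $d\ge 2$ and $Y\in\mathcal{M}_{\mathbf r}\subset\mathbb{R}^{n_1\times\cdots\times n_d}$, with orthonormal bases $\mathbf U_{\le j},\mathbf V_{>j}$ built from orthogonal TT-cores of $Y$ as in the context. If the index sets $I^{\le j},I^{>j}$, $j=1,\dots,d-1$, are obtained with the TT-cross-DEIM algorithm described in the context, then the $r_j\times r_j$ matrices $\mathbf M_j$ and $\mathbf N_j$ with entries $$\mathbf M_j(\alpha_j,\beta_j)=\mathbf U_{\le j}\bigl(I^{\le j}_{\alpha_j},\beta_j\bigr),\qquad \mathbf N_j(\alpha_j,\beta_j)=\mathbf V_{>j}\bigl(I^{>j}_{\alpha_j},\beta_j\bigr)$$ are invertible for all $j=1,2,\dots,d-1$.
   Context: TT-rank and manifold: for $Y\in\mathbb{R}^{n_1\times\cdots\times n_d}$, $\mathbf Y^{\langle k\rangle}\in\mathbb{R}^{(n_1\cdots n_k)\times(n_{k+1}\cdots n_d)}$ is the unfolding with rows indexed by $(i_1,\dots,i_k)$ and columns by $(i_{k+1},\dots,i_d)$, ordered colexicographically. The TT-rank of $Y$ is $\mathbf r=(1,r_1,\dots,r_{d-1},1)$ with $r_k=\operatorname{rank}\mathbf Y^{\langle k\rangle}$ (so $r_0=r_d=1$), and $\mathcal{M}_{\mathbf r}=\{Y:\text{TT-rank}(Y)=\mathbf r\}$. Orthogonal decompositions: $U_1,\dots,U_{d-1}$ are left-orthogonal TT-cores and $V_2,\dots,V_d$ right-orthogonal TT-cores of $Y$ ($U_k,V_k\in\mathbb{R}^{r_{k-1}\times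 n_k\times r_k}$, with $U_k(i_k),V_k(i_k)$ the $r_{k-1}\times r_k$ slices; left-orthogonal means the $r_{k-1}n_k\times r_k$ reshaping of $U_k$ has orthonormal columns, right-orthogonal means the $r_{k-1}\times n_kr_k$ reshaping of $V_k$ has orthonormal rows), such that for every $k=1,\dots,d-1$, $Y(i_1,\dots,i_d)=U_1(i_1)\cdots U_k(i_k)\,\mathbf S_k\,V_{k+1}(i_{k+1})\cdots V_d(i_d)$ with $\mathbf S_k\in\mathbb{R}^{r_k\times r_k}$ invertible. The matrices $\mathbf U_{\le k}\in\mathbb{R}^{(n_1\cdots n_k)\times r_k}$ and $\mathbf V_{>k}\in\mathbb{R}^{(n_{k+1}\cdots n_d)\times r_k}$ have rows $\mathbf U_{\le k}(i_1\cdots i_k,:)=U_1(i_1)\cdots U_k(i_k)$ and $\mathbf V_{>k}(i_{k+1}\cdots i_d,:)=\bigl(V_{k+1}(i_{k+1})\cdots V_d(i_d)\bigr)^{\top}$; their columns are orthonormal bases of the range and co-range of $\mathbf Y^{\langle k\rangle}$. DEIM: for a matrix $\mathbf V\in\mathbb{R}^{n\times r}$ with $n\ge r$, $\mathtt{DEIM}(\mathbf V)$ is a vector $\mathbf l=(l_1,\dots,l_r)$ of distinct indices from $\{1,\dots,n\}$ computed as follows. $l_1$ is an index maximizing $|\mathbf V(\cdot,1)|$. For $j=2,\dots,r$, with $\mathbf l=(l_1,\dots,l_{j-1})$ and $\mathbf v=\mathbf V(:,j)$, set $\mathbf c=\mathbf V(\mathbf l,1{:}j-1)^{-1}\mathbf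 v(\mathbf l)$ and $\mathbf q=\mathbf v-\mathbf V(:,1{:}j-1)\mathbf c$, and let $l_j$ be an index maximizing the absolute value of the entries of $\mathbf q$. TT-cross-DEIM: $\mathcal I^{\le j}$ is an ordered list of $r_j$ multi-indices $(i_1,\dots,i_j)$ and $\mathcal I^{>j}$ an ordered list of $r_j$ multi-indices $(i_{j+1},\dots,i_d)$; $I^{\le j},I^{>j}$ are the corresponding lists of row indices of $\mathbf U_{\le j}$ and $\mathbf V_{>j}$; the subscript $\alpha$ denotes the $\alpha$-th element of a list. (Left-to-right sweep) $I^{\le 1}=\mathtt{DEIM}(\mathbf U_{\le 1})$. For $j=2,\dots,d-1$: form the $r_{j-1}n_j\times r_j$ matrix $\widehat{\mathbf U}_{\le j}(\alpha_{j-1}i_j,\alpha_j)=\mathbf U_{\le j}(I^{\le j-1}_{\alpha_{j-1}}i_j,\alpha_j)$, with rows indexed by pairs $(\alpha_{j-1},i_j)$ (colexicographically); compute $\mathbf l_{\le j}=\mathtt{DEIM}(\widehat{\mathbf U}_{\le j})$; writing the pair corresponding to $\mathbf l_{\le j}(\alpha_j)$ as $(\mathbf p_{\le j-1}(\alpha_j),\mathbf p_j(\alpha_j))$, set $\mathcal I^{\le j}_{\alpha_j}=\bigl(\mathcal I^{\le j-1}_{\mathbf p_{\le j-1}(\alpha_j)},\mathbf p_j(\alpha_j)\bigr)$ for $\alpha_j=1,\dots,r_j$. (Right-to-left sweep) $I^{>d-1}=\mathtt{DEIM}(\mathbf V_{>d-1})$. For $j=d-2,\dots,1$: form the $n_{j+1}r_{j+1}\times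 r_j$ matrix $\widehat{\mathbf V}_{>j}(i_{j+1}\alpha_{j+1},\alpha_j)=\mathbf V_{>j}(i_{j+1}I^{>j+1}_{\alpha_{j+1}},\alpha_j)$; compute $\mathbf l_{>j}=\mathtt{DEIM}(\widehat{\mathbf V}_{>j})$; writing the pair corresponding to $\mathbf l_{>j}(\alpha_j)$ as $(\mathbf p_{j+1}(\alpha_j),\mathbf p_{>j+1}(\alpha_j))$, set $\mathcal I^{>j}_{\alpha_j}=\bigl(\mathbf p_{j+1}(\alpha_j),\mathcal I^{>j+1}_{\mathbf p_{>j+1}(\alpha_j)}\bigr)$ for $\alpha_j=1,\dots,r_j$. *)

theory Defs
  imports "Jordan_Normal_Form.DL_Rank" "Jordan_Normal_Form.Gauss_Jordan_Elimination"
begin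

text \<open>
  Conventions.  Index values \<open>i\<^sub>k\<close>, \<open>\<alpha>\<^sub>k\<close> and matrix entries count from \<open>0\<close>; modes, cores and bonds
  keep their usual numbering: \<open>n k\<close> for \<open>k = 1, \<dots>, d\<close>, \<open>r k\<close> for \<open>k = 0, \<dots>, d\<close>, and core \<open>k\<close> sits
  between the bonds \<open>k - 1\<close> and \<open>k\<close>.  A tensor is a function on multi-indices \<open>[i\<^sub>1, \<dots>, i\<^sub>d]\<close>, a core is
  the family of its slices; their values outside the index ranges are never used.
\<close>

type_synonym tensor = "nat list \<Rightarrow> real"
type_synonym core = "nat \<Rightarrow> real mat"


section \<open>Multi-indices and unfoldings\<close>

definition multi_indices :: "nat list \<Rightarrow> nat list set" where
  "multi_indices ns = {is. list_all2 (<) is ns}"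

text \<open>Colexicographic order: the first index runs fastest.\<close>

fun colex_index :: "nat list \<Rightarrow> nat list \<Rightarrow> nat" where
  "colex_index (n # ns) (i # is) = i + n * colex_index ns is"
| "colex_index _ _ = 0"

fun colex_multi :: "nat list \<Rightarrow> nat \<Rightarrow> nat list" where
  "colex_multi [] p = []"
| "colex_multi (n # ns) p = (p mod n) # colex_multi ns (p div n)"

lemma colex_multi_index: "is \<in> multi_indices ns \<Longrightarrow> colex_multi ns (colex_index ns is) = is"
proof -
  have "list_all2 (<) is ns \<Longrightarrow> colex_multi ns (colex_index ns is) = is"
    by (induction rule: list_all2_induct) auto
  then show "is \<in> multi_indices ns \<Longrightarrow> ?thesis" by (simp add: multi_indices_def)
qed

definition left_modes :: "(nat \<Rightarrow> nat) \<Rightarrow> nat \<Rightarrow> nat list" where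
  "left_modes n k = map n [1..<k + 1]"

definition right_modes :: "nat \<Rightarrow> (nat \<Rightarrow> nat) \<Rightarrow> nat \<Rightarrow> nat list" where
  "right_modes d n k = map n [k + 1..<d + 1]"

definition unfolding_mat :: "nat \<Rightarrow> (nat \<Rightarrow> nat) \<Rightarrow> tensor \<Rightarrow> nat \<Rightarrow> real mat" where
  "unfolding_mat d n Y k =
     mat (prod_list (left_modes n k)) (prod_list (right_modes d n k))
       (\<lambda>(p, q). Y (colex_multi (left_modes n k) p @ colex_multi (right_modes d n k) q))"

definition tt_rank :: "nat \<Rightarrow> (nat \<Rightarrow> nat) \<Rightarrow> tensor \<Rightarrow> nat \<Rightarrow> nat" where
  "tt_rank d n Y k =
     (if k = 0 \<or> k = d then 1
      else vec_space.rank (dim_row (unfolding_mat d n Y k)) (unfolding_mat d n Y k))"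

definition tt_manifold :: "nat \<Rightarrow> (nat \<Rightarrow> nat) \<Rightarrow> (nat \<Rightarrow> nat) \<Rightarrow> tensor set" where
  "tt_manifold d n r = {Y. \<forall>k\<le>d. tt_rank d n Y k = r k}"


section \<open>Orthogonal TT decompositions\<close>

definition orthonormal_cols :: "real mat \<Rightarrow> bool" where
  "orthonormal_cols A \<longleftrightarrow>
     (\<forall>a<dim_col A. \<forall>b<dim_col A. col A a \<bullet> col A b = (if a = b then 1 else 0))"

definition orthonormal_rows :: "real mat \<Rightarrow> bool" where
  "orthonormal_rows A \<longleftrightarrow>
     (\<forall>a<dim_row A. \<forall>b<dim_row A. row A a \<bullet> row A b = (if a = b then 1 else 0))"

text \<open>The two reshapings of a core of size \<open>r\<^sub>0 \<times> n \<times> r\<^sub>1\<close>, with colexicographic pairs.\<close>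

definition left_reshape :: "nat \<Rightarrow> nat \<Rightarrow> nat \<Rightarrow> core \<Rightarrow> real mat" where
  "left_reshape r0 n r1 G = mat (r0 * n) r1 (\<lambda>(p, b). G (p div r0) $$ (p mod r0, b))"

definition right_reshape :: "nat \<Rightarrow> nat \<Rightarrow> nat \<Rightarrow> core \<Rightarrow> real mat" where
  "right_reshape r0 n r1 G = mat r0 (n * r1) (\<lambda>(a, q). G (q mod n) $$ (a, q div n))"

definition is_core :: "nat \<Rightarrow> nat \<Rightarrow> nat \<Rightarrow> core \<Rightarrow> bool" where
  "is_core r0 n r1 G \<longleftrightarrow> (\<forall>i<n. G i \<in> carrier_mat r0 r1)"

definition left_orthogonal_core :: "nat \<Rightarrow> nat \<Rightarrow> nat \<Rightarrow> core \<Rightarrow> bool" where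
  "left_orthogonal_core r0 n r1 G \<longleftrightarrow>
     is_core r0 n r1 G \<and> orthonormal_cols (left_reshape r0 n r1 G)"

definition right_orthogonal_core :: "nat \<Rightarrow> nat \<Rightarrow> nat \<Rightarrow> core \<Rightarrow> bool" where
  "right_orthogonal_core r0 n r1 G \<longleftrightarrow>
     is_core r0 n r1 G \<and> orthonormal_rows (right_reshape r0 n r1 G)"

text \<open>
  \<open>slice_prod r G k [i, i', \<dots>]\<close> is the product \<open>G\<^bsub>k+1\<^esub>(i) G\<^bsub>k+2\<^esub>(i') \<cdots>\<close> starting at bond \<open>k\<close>.
\<close>

fun slice_prod :: "(nat \<Rightarrow> nat) \<Rightarrow> (nat \<Rightarrow> core) \<Rightarrow> nat \<Rightarrow> nat list \<Rightarrow> real mat" where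
  "slice_prod r G k [] = 1\<^sub>m (r k)"
| "slice_prod r G k (i # is) = G (Suc k) i * slice_prod r G (Suc k) is"

definition orthogonal_tt_decomposition ::
    "nat \<Rightarrow> (nat \<Rightarrow> nat) \<Rightarrow> (nat \<Rightarrow> nat) \<Rightarrow> tensor \<Rightarrow> (nat \<Rightarrow> core) \<Rightarrow> (nat \<Rightarrow> core) \<Rightarrow> bool" where
  "orthogonal_tt_decomposition d n r Y U V \<longleftrightarrow>
     (\<forall>k\<in>{1..d - 1}. left_orthogonal_core (r (k - 1)) (n k) (r k) (U k)) \<and>
     (\<forall>k\<in>{2..d}. right_orthogonal_core (r (k - 1)) (n k) (r k) (V k)) \<and>
     (\<forall>k\<in>{1..d - 1}. \<exists>S \<in> carrier_mat (r k) (r k). invertible_mat S \<and>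
        (\<forall>is \<in> multi_indices (map n [1..<d + 1]).
           Y is = (slice_prod r U 0 (take k is) * S * slice_prod r V k (drop k is)) $$ (0, 0)))"

definition U_le :: "(nat \<Rightarrow> nat) \<Rightarrow> (nat \<Rightarrow> nat) \<Rightarrow> (nat \<Rightarrow> core) \<Rightarrow> nat \<Rightarrow> real mat" where
  "U_le n r U k =
     mat (prod_list (left_modes n k)) (r k)
       (\<lambda>(p, b). slice_prod r U 0 (colex_multi (left_modes n k) p) $$ (0, b))"

definition V_gt ::
    "nat \<Rightarrow> (nat \<Rightarrow> nat) \<Rightarrow> (nat \<Rightarrow> nat) \<Rightarrow> (nat \<Rightarrow> core) \<Rightarrow> nat \<Rightarrow> real mat" where
  "V_gt d n r V k =
     mat (prod_list (right_modes d n k)) (r k)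
       (\<lambda>(p, b). slice_prod r V k (colex_multi (right_modes d n k) p) $$ (b, 0))"


section \<open>DEIM\<close>

text \<open>
  The vector \<open>q\<close> of step \<open>j\<close> (column \<open>j\<close>, counted from \<open>0\<close>); only \<open>l ! 0, \<dots>, l ! (j - 1)\<close> are used.
  If the matrix to be inverted is singular, the result is unspecified: \<open>DEIM\<close> below does
  not presuppose that the inverses occurring in the algorithm exist.
\<close>

definition deim_residual :: "real mat \<Rightarrow> nat list \<Rightarrow> nat \<Rightarrow> real vec" where
  "deim_residual V l j =
     (let A = mat j j (\<lambda>(a, b). V $$ (l ! a, b));
          c = the (mat_inverse A) *\<^sub>v vec j (\<lambda>a. V $$ (l ! a, j))
      in col V j - mat (dim_row V) j (\<lambda>(i, b). V $$ (i, b)) *\<^sub>v c)"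

definition max_abs_index :: "real vec \<Rightarrow> nat \<Rightarrow> bool" where
  "max_abs_index q i \<longleftrightarrow> is_arg_max (\<lambda>i. \<bar>q $ i\<bar>) (\<lambda>i. i < dim_vec q) i"

text \<open>
  \<open>DEIM V l\<close>: the list \<open>l\<close> is a possible output of the algorithm on \<open>V\<close>.  This is a relation since
  ties in the maximizations may be resolved arbitrarily.  Distinctness of the selected indices
  is not imposed separately; for \<open>V\<close> of full column rank it follows from the maximizations, as
  then \<open>q \<noteq> 0\<close> while \<open>q\<close> vanishes at the indices selected before.
\<close>

definition DEIM :: "real mat \<Rightarrow> nat list \<Rightarrow> bool" where
  "DEIM V l \<longleftrightarrow>
     length l = dim_col V \<and>
     (0 < dim_col V \<longrightarrow> max_abs_index (col V 0) (l ! 0)) \<and>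
     (\<forall>j\<in>{1..<dim_col V}. max_abs_index (deim_residual V l j) (l ! j))"


section \<open>The TT-cross-DEIM sweeps\<close>

text \<open>
  \<open>I j\<close> and \<open>J j\<close> are the ordered lists of multi-indices \<open>\<I>\<^bsup>\<le>j\<^esup>\<close> and \<open>\<I>\<^bsup>>j\<^esup>\<close>.  \<open>rows_le\<close> and \<open>rows_gt\<close>
  are the corresponding lists of row indices.
\<close>

definition rows_le :: "(nat \<Rightarrow> nat) \<Rightarrow> (nat \<Rightarrow> nat list list) \<Rightarrow> nat \<Rightarrow> nat list" where
  "rows_le n I j = map (colex_index (left_modes n j)) (I j)"

definition rows_gt :: "nat \<Rightarrow> (nat \<Rightarrow> nat) \<Rightarrow> (nat \<Rightarrow> nat list list) \<Rightarrow> nat \<Rightarrow> nat list" where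
  "rows_gt d n J j = map (colex_index (right_modes d n j)) (J j)"

text \<open>
  The multi-index belonging to a colexicographic pair \<open>p = (\<alpha>\<^bsub>j-1\<^esub>, i\<^sub>j)\<close>, respectively
  \<open>p = (i\<^bsub>j+1\<^esub>, \<alpha>\<^bsub>j+1\<^esub>)\<close>.
\<close>

definition extend_le :: "(nat \<Rightarrow> nat) \<Rightarrow> (nat \<Rightarrow> nat list list) \<Rightarrow> nat \<Rightarrow> nat \<Rightarrow> nat list" where
  "extend_le r I j p = I (j - 1) ! (p mod r (j - 1)) @ [p div r (j - 1)]"

definition extend_gt :: "(nat \<Rightarrow> nat) \<Rightarrow> (nat \<Rightarrow> nat list list) \<Rightarrow> nat \<Rightarrow> nat \<Rightarrow> nat list" where
  "extend_gt n J j p = (p mod n (j + 1)) # J (j + 1) ! (p div n (j + 1))"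

definition U_hat ::
    "(nat \<Rightarrow> nat) \<Rightarrow> (nat \<Rightarrow> nat) \<Rightarrow> (nat \<Rightarrow> core) \<Rightarrow> (nat \<Rightarrow> nat list list) \<Rightarrow> nat \<Rightarrow> real mat" where
  "U_hat n r U I j =
     mat (r (j - 1) * n j) (r j)
       (\<lambda>(p, b). U_le n r U j $$ (colex_index (left_modes n j) (extend_le r I j p), b))"

definition V_hat ::
    "nat \<Rightarrow> (nat \<Rightarrow> nat) \<Rightarrow> (nat \<Rightarrow> nat) \<Rightarrow> (nat \<Rightarrow> core) \<Rightarrow> (nat \<Rightarrow> nat list list) \<Rightarrow> nat \<Rightarrow> real mat" where
  "V_hat d n r V J j =
     mat (n (j + 1) * r (j + 1)) (r j)
       (\<lambda>(p, b). V_gt d n r V j $$ (colex_index (right_modes d n j) (extend_gt n J j p), b))"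

definition left_to_right_sweep ::
    "nat \<Rightarrow> (nat \<Rightarrow> nat) \<Rightarrow> (nat \<Rightarrow> nat) \<Rightarrow> (nat \<Rightarrow> core) \<Rightarrow> (nat \<Rightarrow> nat list list) \<Rightarrow> bool" where
  "left_to_right_sweep d n r U I \<longleftrightarrow>
     (\<exists>l. DEIM (U_le n r U 1) l \<and> I 1 = map (\<lambda>p. [p]) l) \<and>
     (\<forall>j\<in>{2..d - 1}. \<exists>l. DEIM (U_hat n r U I j) l \<and> I j = map (extend_le r I j) l)"

definition right_to_left_sweep ::
    "nat \<Rightarrow> (nat \<Rightarrow> nat) \<Rightarrow> (nat \<Rightarrow> nat) \<Rightarrow> (nat \<Rightarrow> core) \<Rightarrow> (nat \<Rightarrow> nat list list) \<Rightarrow> bool" where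
  "right_to_left_sweep d n r V J \<longleftrightarrow>
     (\<exists>l. DEIM (V_gt d n r V (d - 1)) l \<and> J (d - 1) = map (\<lambda>p. [p]) l) \<and>
     (\<forall>j\<in>{1..d - 2}. \<exists>l. DEIM (V_hat d n r V J j) l \<and> J j = map (extend_gt n J j) l)"

definition M_mat ::
    "(nat \<Rightarrow> nat) \<Rightarrow> (nat \<Rightarrow> nat) \<Rightarrow> (nat \<Rightarrow> core) \<Rightarrow> (nat \<Rightarrow> nat list list) \<Rightarrow> nat \<Rightarrow> real mat" where
  "M_mat n r U I j = mat (r j) (r j) (\<lambda>(a, b). U_le n r U j $$ (rows_le n I j ! a, b))"

definition N_mat ::
    "nat \<Rightarrow> (nat \<Rightarrow> nat) \<Rightarrow> (nat \<Rightarrow> nat) \<Rightarrow> (nat \<Rightarrow> core) \<Rightarrow> (nat \<Rightarrow> nat list list) \<Rightarrow> nat \<Rightarrow> real mat" where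
  "N_mat d n r V J j = mat (r j) (r j) (\<lambda>(a, b). V_gt d n r V j $$ (rows_gt d n J j ! a, b))"

end

theory Submission
  imports Defs
begin

text \<open>
  DEIM applied to a matrix of full column rank selects an invertible square submatrix: as long as
  the leading submatrix is invertible, the residual is a nonzero vector that vanishes at the indices
  selected so far, so its largest entry provides a nonzero pivot for the next column.  It remains to
  see that the matrices passed to DEIM have full column rank.  The row of the matrix
  \<open>U_hat n r U I j\<close> at the pair \<open>(\<alpha>, i)\<close> is row \<open>\<alpha>\<close> of the invertible matrix selected at bond
  \<open>j - 1\<close>, multiplied by the slice \<open>U j i\<close>.  Hence a vector in the kernel is annihilated by all
  slices of the core, and orthogonality of the core makes it zero.  The other sweep is symmetric.
\<close>

section \<open>Trivial kernels, determinants and inverses\<close>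

text \<open>This is full column rank. Test vectors are plain functions, read only below
  \<open>dim_col A\<close>, so that sums over entries can be rearranged without carrier
  conditions.\<close>

definition trivial_kernel :: "real mat \<Rightarrow> bool" where
  "trivial_kernel A \<longleftrightarrow>
     (\<forall>x. (\<forall>i<dim_row A. (\<Sum>b<dim_col A. A $$ (i, b) * x b) = 0) \<longrightarrow> (\<forall>b<dim_col A. x b = 0))"

lemma trivial_kernelI:
  assumes "\<And>x b. (\<And>i. i < dim_row A \<Longrightarrow> (\<Sum>b<dim_col A. A $$ (i, b) * x b) = 0) \<Longrightarrow> b < dim_col A \<Longrightarrow> x b = 0"
  shows "trivial_kernel A"
  using assms unfolding trivial_kernel_def by blast

lemma trivial_kernelD:
  assumes "trivial_kernel A"
    and "\<And>i. i < dim_row A \<Longrightarrow> (\<Sum>b<dim_col A. A $$ (i, b) * x b) = 0"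
    and "b < dim_col A"
  shows "x b = 0"
  using assms unfolding trivial_kernel_def by blast

lemma mult_mat_vec_index_sum:
  assumes "A \<in> carrier_mat m n" "v \<in> carrier_vec n" "i < m"
  shows "(A *\<^sub>v v) $ i = (\<Sum>b<n. A $$ (i, b) * v $ b)"
  using assms by (auto simp: scalar_prod_def atLeast0LessThan intro!: sum.cong)

lemma trivial_kernel_det_nonzero:
  assumes A: "A \<in> carrier_mat m m" and "trivial_kernel A"
  shows "det A \<noteq> 0"
proof
  assume "det A = 0"
  then obtain v where v: "v \<in> carrier_vec m" "v \<noteq> 0\<^sub>v m" "A *\<^sub>v v = 0\<^sub>v m"
    using det_0_iff_vec_prod_zero[OF A] by auto
  have "v $ b = 0" if "b < m" for b
  proof (rule trivial_kernelD[OF assms(2)])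
    show "b < dim_col A" using A that by simp
    show "(\<Sum>b<dim_col A. A $$ (i, b) * v $ b) = 0" if "i < dim_row A" for i
      using mult_mat_vec_index_sum[OF A v(1), of i] v(3) A that by auto
  qed
  then show False using v(1,2) by (auto intro: eq_vecI)
qed

text \<open>A nonzero determinant makes \<open>A\<close> a unit of the matrix ring, and there
  \<open>mat_inverse\<close> returns \<open>Some\<close>. This resolves the \<open>the\<close> in
  \<open>deim_residual\<close>.\<close>

lemma det_nonzero_mat_inverse:
  fixes A :: "'a :: field mat"
  assumes A: "A \<in> carrier_mat m m" and "det A \<noteq> 0"
  obtains B where "mat_inverse A = Some B" "B \<in> carrier_mat m m" "A * B = 1\<^sub>m m" "B * A = 1\<^sub>m m"
proof -
  have "A \<in> Units (ring_mat TYPE('a) m ())"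
    using det_non_zero_imp_unit[OF assms] .
  then have "mat_inverse A \<noteq> None"
    using mat_inverse(1)[OF A, where b = "()"] by blast
  then show ?thesis using mat_inverse(2)[OF A] that by blast
qed

lemma trivial_kernel_invertible:
  assumes "A \<in> carrier_mat m m" "trivial_kernel A"
  shows "invertible_mat A"
proof -
  from det_nonzero_mat_inverse[OF assms(1) trivial_kernel_det_nonzero[OF assms]]
  obtain B where "B \<in> carrier_mat m m" "A * B = 1\<^sub>m m" "B * A = 1\<^sub>m m" .
  then show ?thesis
    using assms(1) by (auto simp: invertible_mat_def inverts_mat_def)
qed

text \<open>The Gram matrix of the columns is the identity, so \<open>x\<close> is the transpose of
  \<open>A\<close> applied to \<open>A x\<close>, hence zero. The chain is this computation in
  coordinates.\<close>

lemma orthonormal_cols_trivial_kernel: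
  assumes "orthonormal_cols A"
  shows "trivial_kernel A"
proof (rule trivial_kernelI)
  fix x :: "nat \<Rightarrow> real" and a
  assume ker: "\<And>i. i < dim_row A \<Longrightarrow> (\<Sum>b<dim_col A. A $$ (i, b) * x b) = 0" and a: "a < dim_col A"
  have "x a = (\<Sum>b<dim_col A. if a = b then x b else 0)"
    using a by simp
  also have "\<dots> = (\<Sum>b<dim_col A. (col A a \<bullet> col A b) * x b)"
    using assms a by (intro sum.cong) (auto simp: orthonormal_cols_def)
  also have "\<dots> = (\<Sum>b<dim_col A. \<Sum>i<dim_row A. A $$ (i, a) * (A $$ (i, b) * x b))"
    using a by (auto simp: scalar_prod_def atLeast0LessThan sum_distrib_right mult.assoc intro!: sum.cong)
  also have "\<dots> = (\<Sum>i<dim_row A. A $$ (i, a) * (\<Sum>b<dim_col A. A $$ (i, b) * x b))"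
    by (subst sum.swap) (simp add: sum_distrib_left)
  also have "\<dots> = 0" using ker by simp
  finally show "x a = 0" .
qed

lemma orthonormal_rows_trivial_kernel:
  assumes "orthonormal_rows A"
  shows "trivial_kernel A\<^sup>T"
  using assms by (intro orthonormal_cols_trivial_kernel)
    (simp add: orthonormal_cols_def orthonormal_rows_def)

section \<open>Passing full column rank across one orthogonal core\<close>

lemma mat_mult_index_sum:
  assumes "A \<in> carrier_mat m k" "B \<in> carrier_mat k n" "i < m" "j < n"
  shows "(A * B) $$ (i, j) = (\<Sum>c<k. A $$ (i, c) * B $$ (c, j))"
  using assms by (auto simp: scalar_prod_def atLeast0LessThan intro!: sum.cong)

lemma pair_index_less:
  fixes a m i n :: nat
  assumes "a < m" "i < n"
  shows "a + m * i < m * n"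
proof -
  have "m * Suc i \<le> m * n" using assms(2) by (intro mult_le_mono2) simp
  then show ?thesis using assms(1) by simp
qed

lemma mod_div_pair_less:
  fixes p m n :: nat
  assumes "p < m * n"
  shows "p mod m < m" "p div m < n"
proof -
  have "m > 0" using assms by (cases m) auto
  then show "p mod m < m" by simp
  show "p div m < n" using assms by (intro less_mult_imp_div_less) (simp add: mult.commute)
qed

text \<open>\<open>W \<alpha>\<close> stands for the slice product at the selected multi-index
  number \<open>\<alpha>\<close>. For fixed \<open>i\<close>, the rows of the product matrix say
  that the selected square matrix kills \<open>G i x\<close>. So every slice kills \<open>x\<close>,
  and the slices stacked are the left reshaping.\<close>

lemma trivial_kernel_left_step:
  assumes W: "\<And>\<alpha>. \<alpha> < r0 \<Longrightarrow> W \<alpha> \<in> carrier_mat 1 r0"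
    and M: "trivial_kernel (mat r0 r0 (\<lambda>(\<alpha>, c). W \<alpha> $$ (0, c)))"
    and G: "left_orthogonal_core r0 n r1 G"
  shows "trivial_kernel (mat (r0 * n) r1 (\<lambda>(p, b). (W (p mod r0) * G (p div r0)) $$ (0, b)))"
proof (rule trivial_kernelI, unfold dim_row_mat dim_col_mat)
  fix x :: "nat \<Rightarrow> real" and a
  assume ker: "\<And>p. p < r0 * n \<Longrightarrow> (\<Sum>b<r1. mat (r0 * n) r1
      (\<lambda>(p, b). (W (p mod r0) * G (p div r0)) $$ (0, b)) $$ (p, b) * x b) = 0"
    and a: "a < r1"
  have Gi: "G i \<in> carrier_mat r0 r1" if "i < n" for i
    using G that by (simp add: left_orthogonal_core_def is_core_def)
  have slice: "(\<Sum>b<r1. G i $$ (c, b) * x b) = 0" if i: "i < n" and c: "c < r0" for i c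
  proof -
    have "(\<Sum>c<r0. W \<alpha> $$ (0, c) * (\<Sum>b<r1. G i $$ (c, b) * x b)) = 0" if \<alpha>: "\<alpha> < r0" for \<alpha>
    proof -
      have "(\<Sum>c<r0. W \<alpha> $$ (0, c) * (\<Sum>b<r1. G i $$ (c, b) * x b)) =
          (\<Sum>b<r1. \<Sum>c<r0. W \<alpha> $$ (0, c) * (G i $$ (c, b) * x b))"
        by (subst sum.swap) (simp add: sum_distrib_left)
      also have "\<dots> = (\<Sum>b<r1. (W \<alpha> * G i) $$ (0, b) * x b)"
        by (rule sum.cong)
          (simp_all add: mat_mult_index_sum[OF W[OF \<alpha>] Gi[OF i]] sum_distrib_right mult.assoc
            del: index_mult_mat)
      \<comment> \<open>The row used is at position \<open>\<alpha> + r0 * i\<close>, whose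
        remainder and quotient by \<open>r0\<close> are \<open>\<alpha>\<close> and
        \<open>i\<close>.\<close>
      also have "\<dots> = 0"
        using ker[OF pair_index_less[OF \<alpha> i]] pair_index_less[OF \<alpha> i] \<alpha> by simp
      finally show ?thesis .
    qed
    then show ?thesis
      by (intro trivial_kernelD[OF M, where x = "\<lambda>c. \<Sum>b<r1. G i $$ (c, b) * x b"])
        (simp_all add: c)
  qed
  have "trivial_kernel (left_reshape r0 n r1 G)"
    using G by (simp add: left_orthogonal_core_def orthonormal_cols_trivial_kernel)
  then show "x a = 0"
  proof (rule trivial_kernelD)
    show "a < dim_col (left_reshape r0 n r1 G)" using a by (simp add: left_reshape_def)
    fix p assume "p < dim_row (left_reshape r0 n r1 G)"
    then have p: "p < r0 * n" by (simp add: left_reshape_def)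
    from mod_div_pair_less[OF p] show "(\<Sum>b<dim_col (left_reshape r0 n r1 G). left_reshape r0 n r1 G $$ (p, b) * x b) = 0"
      using p slice by (simp add: left_reshape_def)
  qed
qed

text \<open>The transposed argument: slices act on \<open>x\<close> from the other side, and
  orthonormal rows of the right reshaping give its transpose a trivial kernel. Here the slice index
  runs fastest, so the pair sits at \<open>i + n * \<alpha>\<close>.\<close>

lemma trivial_kernel_right_step:
  assumes W: "\<And>\<alpha>. \<alpha> < r1 \<Longrightarrow> W \<alpha> \<in> carrier_mat r1 1"
    and M: "trivial_kernel (mat r1 r1 (\<lambda>(\<alpha>, c). W \<alpha> $$ (c, 0)))"
    and G: "right_orthogonal_core r0 n r1 G"
  shows "trivial_kernel (mat (n * r1) r0 (\<lambda>(p, b). (G (p mod n) * W (p div n)) $$ (b, 0)))"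
proof (rule trivial_kernelI, unfold dim_row_mat dim_col_mat)
  fix x :: "nat \<Rightarrow> real" and a
  assume ker: "\<And>p. p < n * r1 \<Longrightarrow> (\<Sum>b<r0. mat (n * r1) r0
      (\<lambda>(p, b). (G (p mod n) * W (p div n)) $$ (b, 0)) $$ (p, b) * x b) = 0"
    and a: "a < r0"
  have Gi: "G i \<in> carrier_mat r0 r1" if "i < n" for i
    using G that by (simp add: right_orthogonal_core_def is_core_def)
  have slice: "(\<Sum>b<r0. G i $$ (b, c) * x b) = 0" if i: "i < n" and c: "c < r1" for i c
  proof -
    have "(\<Sum>c<r1. W \<alpha> $$ (c, 0) * (\<Sum>b<r0. G i $$ (b, c) * x b)) = 0" if \<alpha>: "\<alpha> < r1" for \<alpha>
    proof -
      have "(\<Sum>c<r1. W \<alpha> $$ (c, 0) * (\<Sum>b<r0. G i $$ (b, c) * x b)) =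
          (\<Sum>b<r0. \<Sum>c<r1. W \<alpha> $$ (c, 0) * (G i $$ (b, c) * x b))"
        by (subst sum.swap) (simp add: sum_distrib_left)
      also have "\<dots> = (\<Sum>b<r0. (G i * W \<alpha>) $$ (b, 0) * x b)"
        by (rule sum.cong)
          (simp_all add: mat_mult_index_sum[OF Gi[OF i] W[OF \<alpha>]] sum_distrib_left sum_distrib_right ac_simps
            del: index_mult_mat)
      also have "\<dots> = 0"
        using ker[OF pair_index_less[OF i \<alpha>]] pair_index_less[OF i \<alpha>] i by simp
      finally show ?thesis .
    qed
    then show ?thesis
      by (intro trivial_kernelD[OF M, where x = "\<lambda>c. \<Sum>b<r0. G i $$ (b, c) * x b"])
        (simp_all add: c)
  qed
  have "trivial_kernel (right_reshape r0 n r1 G)\<^sup>T"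
    using G by (simp add: right_orthogonal_core_def orthonormal_rows_trivial_kernel)
  then show "x a = 0"
  proof (rule trivial_kernelD)
    show "a < dim_col (right_reshape r0 n r1 G)\<^sup>T" using a by (simp add: right_reshape_def)
    fix p assume "p < dim_row (right_reshape r0 n r1 G)\<^sup>T"
    then have p: "p < n * r1" by (simp add: right_reshape_def)
    from mod_div_pair_less[OF p] show "(\<Sum>b<dim_col (right_reshape r0 n r1 G)\<^sup>T. (right_reshape r0 n r1 G)\<^sup>T $$ (p, b) * x b) = 0"
      using p slice by (simp add: right_reshape_def)
  qed
qed

lemma trivial_kernel_one_mat: "trivial_kernel (1\<^sub>m m)"
  by (intro orthonormal_cols_trivial_kernel) (simp add: orthonormal_cols_def)


section \<open>DEIM\<close>

text \<open>With an invertible leading matrix, \<open>c\<close> consists of genuine interpolation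
  coefficients. The second property says that column \<open>j\<close> is matched at the indices
  chosen before.\<close>

lemma deim_residual_coefficients:
  assumes det: "det (mat j j (\<lambda>(a, b). V $$ (l ! a, b))) \<noteq> 0"
    and j: "j < dim_col V"
  obtains c where
    "\<And>i. i < dim_row V \<Longrightarrow> deim_residual V l j $ i = V $$ (i, j) - (\<Sum>b<j. V $$ (i, b) * c b)"
    "\<And>a. a < j \<Longrightarrow> (\<Sum>b<j. V $$ (l ! a, b) * c b) = V $$ (l ! a, j)"
proof -
  define A where "A = mat j j (\<lambda>(a, b). V $$ (l ! a, b))"
  define v where "v = vec j (\<lambda>a. V $$ (l ! a, j))"
  define c where "c = the (mat_inverse A) *\<^sub>v v"
  have A: "A \<in> carrier_mat j j" by (simp add: A_def)
  have v: "v \<in> carrier_vec j" by (simp add: v_def)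
  obtain B where B: "mat_inverse A = Some B" and Bc: "B \<in> carrier_mat j j" and AB: "A * B = 1\<^sub>m j"
    using det_nonzero_mat_inverse[OF A] det unfolding A_def by metis
  have c: "c = B *\<^sub>v v" "c \<in> carrier_vec j" using B Bc v by (auto simp: c_def)
  have Ac: "A *\<^sub>v c = v"
    using c AB v by (simp add: assoc_mult_mat_vec[OF A Bc v, symmetric])
  show ?thesis
  proof (rule that[where c = "\<lambda>b. c $ b"])
    fix i assume i: "i < dim_row V"
    have res: "deim_residual V l j = col V j - mat (dim_row V) j (\<lambda>(i, b). V $$ (i, b)) *\<^sub>v c"
      by (simp add: deim_residual_def c_def A_def v_def Let_def)
    show "deim_residual V l j $ i = V $$ (i, j) - (\<Sum>b<j. V $$ (i, b) * c $ b)"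
      unfolding res using i j c(2) mult_mat_vec_index_sum[OF mat_carrier c(2) i]
      by (simp del: index_mult_mat_vec)
  next
    fix a assume a: "a < j"
    show "(\<Sum>b<j. V $$ (l ! a, b) * c $ b) = V $$ (l ! a, j)"
      using mult_mat_vec_index_sum[OF A c(2) a] a unfolding Ac by (simp add: A_def v_def)
  qed
qed

text \<open>The empty matrix has determinant 1 and the interpolant is an empty sum, so the first
  choice of DEIM becomes an instance of the general step.\<close>

lemma deim_residual_0:
  assumes "0 < dim_col V"
  shows "deim_residual V l 0 = col V 0"
proof (rule eq_vecI)
  fix i assume "i < dim_vec (col V 0)"
  moreover obtain c where
    "\<And>i. i < dim_row V \<Longrightarrow> deim_residual V l 0 $ i = V $$ (i, 0) - (\<Sum>b<0. V $$ (i, b) * c b)"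
    by (rule deim_residual_coefficients[of 0 V l]) (use assms in auto)
  ultimately show "deim_residual V l 0 $ i = col V 0 $ i" using assms by simp
qed (simp add: deim_residual_def Let_def)

lemma DEIM_max_abs_index:
  assumes "DEIM V l" "j < dim_col V"
  shows "max_abs_index (deim_residual V l j) (l ! j)"
  using assms by (cases "j = 0") (auto simp: DEIM_def deim_residual_0)

text \<open>The residual has \<open>dim_row V\<close> entries whatever \<open>mat_inverse\<close>
  yields, and \<open>is_arg_max\<close> includes the range condition, so the bound holds before any
  invertibility is known.\<close>

lemma DEIM_less:
  assumes "DEIM V l" "p \<in> set l"
  shows "p < dim_row V"
proof -
  obtain j where j: "j < dim_col V" "p = l ! j"
    using assms by (auto simp: DEIM_def in_set_conv_nth)
  have "dim_vec (deim_residual V l j) = dim_row V"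
    by (simp add: deim_residual_def Let_def)
  then show ?thesis
    using DEIM_max_abs_index[OF assms(1) j(1)] j(2) by (simp add: max_abs_index_def is_arg_max_def)
qed

lemma deim_residual_selected_nonzero:
  assumes V: "trivial_kernel V" and D: "DEIM V l" and j: "j < dim_col V"
    and det: "det (mat j j (\<lambda>(a, b). V $$ (l ! a, b))) \<noteq> 0"
  shows "deim_residual V l j $ (l ! j) \<noteq> 0"
proof
  assume zero: "deim_residual V l j $ (l ! j) = 0"
  obtain c where c: "\<And>i. i < dim_row V \<Longrightarrow>
      deim_residual V l j $ i = V $$ (i, j) - (\<Sum>b<j. V $$ (i, b) * c b)"
    using deim_residual_coefficients[OF det j] by metis
  have "dim_vec (deim_residual V l j) = dim_row V"
    by (simp add: deim_residual_def Let_def)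
  \<comment> \<open>The selected entry has the largest absolute value, so if it is zero the whole
    residual is.\<close>
  then have res: "deim_residual V l j $ i = 0" if "i < dim_row V" for i
    using DEIM_max_abs_index[OF D j] zero that by (auto simp: max_abs_index_def is_arg_max_def)
  \<comment> \<open>A zero residual writes column \<open>j\<close> as a combination of the earlier
    columns; \<open>x\<close> collects the coefficients of this dependence.\<close>
  define x where "x b = (if b < j then - c b else if b = j then 1 else 0)" for b
  have "x j = 0"
  proof (rule trivial_kernelD[OF V _ j])
    fix i assume i: "i < dim_row V"
    have "(\<Sum>b<dim_col V. V $$ (i, b) * x b) = (\<Sum>b<Suc j. V $$ (i, b) * x b)"
      using j by (intro sum.mono_neutral_right) (auto simp: x_def)
    also have "\<dots> = V $$ (i, j) - (\<Sum>b<j. V $$ (i, b) * c b)"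
      by (simp add: x_def sum_negf)
    also have "\<dots> = 0" using c[OF i] res[OF i] by simp
    finally show "(\<Sum>b<dim_col V. V $$ (i, b) * x b) = 0" .
  qed
  then show False by (simp add: x_def)
qed

text \<open>One elimination step per column: the rows chosen before express a kernel vector through
  its last entry \<open>x j\<close>, and the new row then reads pivot times \<open>x j\<close>
  equals zero, the pivot being the selected residual entry.\<close>

lemma DEIM_leading_trivial_kernel:
  assumes V: "trivial_kernel V" and D: "DEIM V l"
  shows "j \<le> dim_col V \<Longrightarrow> trivial_kernel (mat j j (\<lambda>(a, b). V $$ (l ! a, b)))"
proof (induction j)
  case 0
  then show ?case by (simp add: trivial_kernel_def)
next
  case (Suc j)
  then have j: "j < dim_col V" and IH: "trivial_kernel (mat j j (\<lambda>(a, b). V $$ (l ! a, b)))"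
    by auto
  have det: "det (mat j j (\<lambda>(a, b). V $$ (l ! a, b))) \<noteq> 0"
    using trivial_kernel_det_nonzero[OF mat_carrier IH] .
  obtain c where c: "\<And>i. i < dim_row V \<Longrightarrow>
        deim_residual V l j $ i = V $$ (i, j) - (\<Sum>b<j. V $$ (i, b) * c b)"
      "\<And>a. a < j \<Longrightarrow> (\<Sum>b<j. V $$ (l ! a, b) * c b) = V $$ (l ! a, j)"
    using deim_residual_coefficients[OF det j] by metis
  have lj: "l ! j < dim_row V" using DEIM_less[OF D] D j by (simp add: DEIM_def)
  show ?case
  proof (rule trivial_kernelI, unfold dim_row_mat dim_col_mat)
    fix x :: "nat \<Rightarrow> real" and b
    assume x: "\<And>a. a < Suc j \<Longrightarrow>
        (\<Sum>b<Suc j. mat (Suc j) (Suc j) (\<lambda>(a, b). V $$ (l ! a, b)) $$ (a, b) * x b) = 0"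
      and b: "b < Suc j"
    have ker: "(\<Sum>b<j. V $$ (l ! a, b) * x b) + V $$ (l ! a, j) * x j = 0" if "a < Suc j" for a
      using x[OF that] that by simp
    \<comment> \<open>Row \<open>a\<close> of the system, with column \<open>j\<close> replaced by
      its interpolant, says that the leading matrix kills \<open>x + x j * c\<close>.\<close>
    have below: "x b + x j * c b = 0" if "b < j" for b
    proof (rule trivial_kernelD[OF IH, where x = "\<lambda>b. x b + x j * c b"])
      show "b < dim_col (mat j j (\<lambda>(a, b). V $$ (l ! a, b)))" using that by simp
      fix a assume "a < dim_row (mat j j (\<lambda>(a, b). V $$ (l ! a, b)))"
      then have a: "a < j" by simp
      have "(\<Sum>b<j. V $$ (l ! a, b) * (x b + x j * c b)) =
          (\<Sum>b<j. V $$ (l ! a, b) * x b) + x j * (\<Sum>b<j. V $$ (l ! a, b) * c b)"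
        by (simp add: distrib_left sum.distrib sum_distrib_left ac_simps)
      also have "\<dots> = 0" using c(2)[OF a] ker[of a] a by (simp add: mult.commute)
      finally show "(\<Sum>b<dim_col (mat j j (\<lambda>(a, b). V $$ (l ! a, b))).
          mat j j (\<lambda>(a, b). V $$ (l ! a, b)) $$ (a, b) * (x b + x j * c b)) = 0"
        using a by simp
    qed
    \<comment> \<open>Substituting \<open>below\<close> turns this product into row \<open>j\<close>
      of the system.\<close>
    have "deim_residual V l j $ (l ! j) * x j =
        V $$ (l ! j, j) * x j - (\<Sum>b<j. V $$ (l ! j, b) * (x j * c b))"
      unfolding c(1)[OF lj] by (simp add: right_diff_distrib sum_distrib_left ac_simps)
    also have "(\<Sum>b<j. V $$ (l ! j, b) * (x j * c b)) = (\<Sum>b<j. V $$ (l ! j, b) * (- x b))"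
    proof (intro sum.cong refl)
      fix b assume "b \<in> {..<j}"
      then have "x j * c b = - x b" using below[of b] by simp
      then show "V $$ (l ! j, b) * (x j * c b) = V $$ (l ! j, b) * (- x b)" by simp
    qed
    also have "V $$ (l ! j, j) * x j - \<dots> = 0" using ker[of j] by (simp add: sum_negf add.commute)
    finally have "x j = 0"
      using deim_residual_selected_nonzero[OF V D j det] by simp
    then show "x b = 0" using below b by (cases "b = j") auto
  qed
qed


section \<open>Multi-indices and products of slices\<close>

lemma colex_index_less:
  assumes "is \<in> multi_indices ns"
  shows "colex_index ns is < prod_list ns"
proof -
  have "list_all2 (<) is ns \<Longrightarrow> ?thesis"
    by (induction rule: list_all2_induct) (auto intro: pair_index_less)
  then show ?thesis using assms by (simp add: multi_indices_def)
qed

lemma left_modes_Suc: "left_modes n (Suc k) = left_modes n k @ [n (Suc k)]"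
  by (simp add: left_modes_def)

lemma right_modes_Suc: "k < d \<Longrightarrow> right_modes d n k = n (Suc k) # right_modes d n (Suc k)"
  by (simp add: right_modes_def upt_conv_Cons del: upt_Suc)

lemma multi_indices_snoc:
  "is @ [i] \<in> multi_indices (ns @ [m]) \<longleftrightarrow> is \<in> multi_indices ns \<and> i < m"
  using list_all2_rev[of "(<)" "is @ [i]" "ns @ [m]"] by (auto simp: multi_indices_def)

lemma multi_indices_Cons:
  "i # is \<in> multi_indices (m # ns) \<longleftrightarrow> i < m \<and> is \<in> multi_indices ns"
  by (auto simp: multi_indices_def)

text \<open>Slice sizes are fixed only for indices in range, hence the membership condition. The
  recursion of \<open>slice_prod\<close> advances the first bond, so the induction generalizes over
  \<open>k0\<close>.\<close>

lemma slice_prod_carrier: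
  assumes "\<And>k. k \<in> {k0<..k1} \<Longrightarrow> is_core (r (k - 1)) (n k) (r k) (G k)"
    and "is \<in> multi_indices (map n [Suc k0..<Suc k1])" and "k0 \<le> k1"
  shows "slice_prod r G k0 is \<in> carrier_mat (r k0) (r k1)"
  using assms
proof (induction "is" arbitrary: k0)
  case Nil
  then have "k0 = k1" by (simp add: multi_indices_def split: if_splits)
  then show ?case by simp
next
  case (Cons i js)
  have "k0 \<noteq> k1" using Cons.prems(2) by (auto simp: multi_indices_def)
  then have k: "k0 < k1" using Cons.prems(3) by simp
  then have i: "i < n (Suc k0)" and js: "js \<in> multi_indices (map n [Suc (Suc k0)..<Suc k1])"
    using Cons.prems(2) by (auto simp: upt_conv_Cons multi_indices_Cons simp del: upt_Suc)
  have "G (Suc k0) i \<in> carrier_mat (r k0) (r (Suc k0))"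
    using Cons.prems(1)[of "Suc k0"] k i by (simp add: is_core_def)
  moreover have "slice_prod r G (Suc k0) js \<in> carrier_mat (r (Suc k0)) (r k1)"
    using Cons.prems(1) js k by (intro Cons.IH) auto
  ultimately show ?case by simp
qed

text \<open>\<open>slice_prod\<close> peels factors off at the left while the left-to-right sweep
  appends at the right. Associativity bridges the two, with sizes from
  \<open>slice_prod_carrier\<close>.\<close>

lemma slice_prod_snoc:
  assumes "\<And>k. k \<in> {k0<..Suc k1} \<Longrightarrow> is_core (r (k - 1)) (n k) (r k) (G k)"
    and "is \<in> multi_indices (map n [Suc k0..<Suc k1])" and "k0 \<le> k1" and "i < n (Suc k1)"
  shows "slice_prod r G k0 (is @ [i]) = slice_prod r G k0 is * G (Suc k1) i"
  using assms
proof (induction "is" arbitrary: k0)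
  case Nil
  then have [simp]: "k0 = k1" by (simp add: multi_indices_def split: if_splits)
  have "G (Suc k1) i \<in> carrier_mat (r k1) (r (Suc k1))"
    using Nil.prems(1)[of "Suc k1"] Nil.prems(4) by (simp add: is_core_def)
  then show ?case by simp
next
  case (Cons a js)
  have "k0 \<noteq> k1" using Cons.prems(2) by (auto simp: multi_indices_def)
  then have k: "k0 < k1" using Cons.prems(3) by simp
  then have a: "a < n (Suc k0)" and js: "js \<in> multi_indices (map n [Suc (Suc k0)..<Suc k1])"
    using Cons.prems(2) by (auto simp: upt_conv_Cons multi_indices_Cons simp del: upt_Suc)
  have Ga: "G (Suc k0) a \<in> carrier_mat (r k0) (r (Suc k0))"
    using Cons.prems(1)[of "Suc k0"] k a by (simp add: is_core_def)
  have Gi: "G (Suc k1) i \<in> carrier_mat (r k1) (r (Suc k1))"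
    using Cons.prems(1)[of "Suc k1"] k Cons.prems(4) by (simp add: is_core_def)
  have P: "slice_prod r G (Suc k0) js \<in> carrier_mat (r (Suc k0)) (r k1)"
    using Cons.prems(1) js k by (intro slice_prod_carrier[where n = n]) auto
  have "slice_prod r G (Suc k0) (js @ [i]) = slice_prod r G (Suc k0) js * G (Suc k1) i"
    using Cons.prems(1,4) js k by (intro Cons.IH) auto
  then show ?case using assoc_mult_mat[OF Ga P Gi] by simp
qed

text \<open>Rows are defined by decoding a row number; encoding a valid multi-index first cancels
  this.\<close>

lemma U_le_colex_index:
  assumes "is \<in> multi_indices (left_modes n k)" "b < r k"
  shows "U_le n r U k $$ (colex_index (left_modes n k) is, b) = slice_prod r U 0 is $$ (0, b)"
  using assms by (simp add: U_le_def colex_index_less colex_multi_index)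

lemma V_gt_colex_index:
  assumes "is \<in> multi_indices (right_modes d n k)" "b < r k"
  shows "V_gt d n r V k $$ (colex_index (right_modes d n k) is, b) = slice_prod r V k is $$ (b, 0)"
  using assms by (simp add: V_gt_def colex_index_less colex_multi_index)


section \<open>The sweeps\<close>

text \<open>The induction step from bond \<open>j\<close> to the next. Length and range of the index
  list are carried along so that list entries decode to actual rows of \<open>U_le\<close>.\<close>

lemma left_sweep_step:
  assumes core: "\<And>k. k \<in> {0<..Suc j} \<Longrightarrow> left_orthogonal_core (r (k - 1)) (n k) (r k) (U k)"
    and r0: "r 0 = 1"
    and I: "length (I j) = r j" "set (I j) \<subseteq> multi_indices (left_modes n j)"
    and M: "trivial_kernel (M_mat n r U I j)"
    and D: "DEIM (U_hat n r U I (Suc j)) l"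
    and ISuc: "I (Suc j) = map (extend_le r I (Suc j)) l"
  shows "length (I (Suc j)) = r (Suc j)" (is ?len)
    and "set (I (Suc j)) \<subseteq> multi_indices (left_modes n (Suc j))" (is ?set)
    and "trivial_kernel (M_mat n r U I (Suc j))" (is ?ker)
proof -
  let ?W = "\<lambda>\<alpha>. slice_prod r U 0 (I j ! \<alpha>)"
  have core': "is_core (r (k - 1)) (n k) (r k) (U k)" if "k \<in> {0<..Suc j}" for k
    using core[OF that] by (simp add: left_orthogonal_core_def)
  have modes: "left_modes n j = map n [Suc 0..<Suc j]" by (simp add: left_modes_def)
  have Imem: "I j ! \<alpha> \<in> multi_indices (left_modes n j)" if "\<alpha> < r j" for \<alpha>
    using I that by (metis nth_mem subsetD)
  have W: "?W \<alpha> \<in> carrier_mat 1 (r j)" if "\<alpha> < r j" for \<alpha>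
    using slice_prod_carrier[of 0 j r n U "I j ! \<alpha>"] core' Imem[OF that] r0
    by (simp add: modes del: upt_Suc)
  \<comment> \<open>This identifies the selected matrix with the one built from the row vectors
    \<open>?W \<alpha>\<close>, as \<open>trivial_kernel_left_step\<close> expects.\<close>
  have "M_mat n r U I j = mat (r j) (r j) (\<lambda>(\<alpha>, c). ?W \<alpha> $$ (0, c))"
    unfolding M_mat_def using I(1) by (intro cong_mat) (auto simp: rows_le_def U_le_colex_index Imem)
  then have ker: "trivial_kernel (mat (r j * n (Suc j)) (r (Suc j))
      (\<lambda>(p, b). (?W (p mod r j) * U (Suc j) (p div r j)) $$ (0, b)))"
    using M W core[of "Suc j"] by (intro trivial_kernel_left_step) auto
  have ext: "extend_le r I (Suc j) p \<in> multi_indices (left_modes n (Suc j))"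
    and prod: "slice_prod r U 0 (extend_le r I (Suc j) p) = ?W (p mod r j) * U (Suc j) (p div r j)"
    if "p < r j * n (Suc j)" for p
    using mod_div_pair_less[OF that] Imem core'
    by (auto simp: extend_le_def left_modes_Suc multi_indices_snoc
        intro!: slice_prod_snoc[where n = n] simp: modes[symmetric] simp del: upt_Suc)
  have hat: "U_hat n r U I (Suc j) = mat (r j * n (Suc j)) (r (Suc j))
      (\<lambda>(p, b). (?W (p mod r j) * U (Suc j) (p div r j)) $$ (0, b))"
    unfolding U_hat_def by (intro cong_mat) (auto simp: U_le_colex_index ext prod)
  have l: "length l = r (Suc j)" using D by (simp add: DEIM_def U_hat_def)
  have less: "p < r j * n (Suc j)" if "p \<in> set l" for p
    using DEIM_less[OF D that] by (simp add: U_hat_def)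
  show ?len by (simp add: ISuc l)
  show ?set using ext less by (auto simp: ISuc)
  \<comment> \<open>The next selected matrix consists of the rows of \<open>U_hat\<close> that DEIM
    picked.\<close>
  have "M_mat n r U I (Suc j) =
      mat (r (Suc j)) (r (Suc j)) (\<lambda>(a, b). U_hat n r U I (Suc j) $$ (l ! a, b))"
    unfolding M_mat_def using l less
    by (intro cong_mat) (auto simp: rows_le_def ISuc U_hat_def)
  then show ?ker
    using DEIM_leading_trivial_kernel[OF ker[folded hat] D, of "r (Suc j)"] by (simp add: U_hat_def)
qed

text \<open>The mirror image, going from bond \<open>Suc j\<close> down to \<open>j\<close>.
  Prepending an index is the defining recursion of \<open>slice_prod\<close>.\<close>

lemma right_sweep_step:
  assumes j: "j < d"
    and core: "\<And>k. k \<in> {j<..d} \<Longrightarrow> right_orthogonal_core (r (k - 1)) (n k) (r k) (V k)"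
    and rd: "r d = 1"
    and J: "length (J (Suc j)) = r (Suc j)"
      "set (J (Suc j)) \<subseteq> multi_indices (right_modes d n (Suc j))"
    and N: "trivial_kernel (N_mat d n r V J (Suc j))"
    and D: "DEIM (V_hat d n r V J j) l"
    and Jj: "J j = map (extend_gt n J j) l"
  shows "length (J j) = r j" (is ?len)
    and "set (J j) \<subseteq> multi_indices (right_modes d n j)" (is ?set)
    and "trivial_kernel (N_mat d n r V J j)" (is ?ker)
proof -
  let ?W = "\<lambda>\<alpha>. slice_prod r V (Suc j) (J (Suc j) ! \<alpha>)"
  have core': "is_core (r (k - 1)) (n k) (r k) (V k)" if "k \<in> {j<..d}" for k
    using core[OF that] by (simp add: right_orthogonal_core_def)
  have modes: "right_modes d n (Suc j) = map n [Suc (Suc j)..<Suc d]" by (simp add: right_modes_def)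
  have Jmem: "J (Suc j) ! \<alpha> \<in> multi_indices (right_modes d n (Suc j))" if "\<alpha> < r (Suc j)" for \<alpha>
    using J that by (metis nth_mem subsetD)
  have W: "?W \<alpha> \<in> carrier_mat (r (Suc j)) 1" if "\<alpha> < r (Suc j)" for \<alpha>
    using slice_prod_carrier[of "Suc j" d r n V "J (Suc j) ! \<alpha>"] core' Jmem[OF that] rd j
    by (simp add: modes del: upt_Suc)
  have "N_mat d n r V J (Suc j) = mat (r (Suc j)) (r (Suc j)) (\<lambda>(\<alpha>, c). ?W \<alpha> $$ (c, 0))"
    unfolding N_mat_def using J(1) by (intro cong_mat) (auto simp: rows_gt_def V_gt_colex_index Jmem)
  then have ker: "trivial_kernel (mat (n (Suc j) * r (Suc j)) (r j)
      (\<lambda>(p, b). (V (Suc j) (p mod n (Suc j)) * ?W (p div n (Suc j))) $$ (b, 0)))"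
    using N W core[of "Suc j"] j by (intro trivial_kernel_right_step) auto
  have ext: "extend_gt n J j p \<in> multi_indices (right_modes d n j)"
    and prod: "slice_prod r V j (extend_gt n J j p) =
      V (Suc j) (p mod n (Suc j)) * ?W (p div n (Suc j))"
    if "p < n (Suc j) * r (Suc j)" for p
    using mod_div_pair_less[OF that] Jmem
    by (auto simp: extend_gt_def right_modes_Suc[OF j] multi_indices_Cons)
  have hat: "V_hat d n r V J j = mat (n (Suc j) * r (Suc j)) (r j)
      (\<lambda>(p, b). (V (Suc j) (p mod n (Suc j)) * ?W (p div n (Suc j))) $$ (b, 0))"
    unfolding V_hat_def by (intro cong_mat) (auto simp: V_gt_colex_index ext prod)
  have l: "length l = r j" using D by (simp add: DEIM_def V_hat_def)
  have less: "p < n (Suc j) * r (Suc j)" if "p \<in> set l" for p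
    using DEIM_less[OF D that] by (simp add: V_hat_def)
  show ?len by (simp add: Jj l)
  show ?set using ext less by (auto simp: Jj)
  have "N_mat d n r V J j = mat (r j) (r j) (\<lambda>(a, b). V_hat d n r V J j $$ (l ! a, b))"
    unfolding N_mat_def using l less by (intro cong_mat) (auto simp: rows_gt_def Jj V_hat_def)
  then show ?ker
    using DEIM_leading_trivial_kernel[OF ker[folded hat] D, of "r j"] by (simp add: V_hat_def)
qed

text \<open>
  The first step of either sweep is an ordinary step that extends the empty multi-index at the
  boundary bond; this is where \<open>I 0\<close> and \<open>J d\<close>, unused by the algorithm, are set to \<open>[[]]\<close>.
\<close>

lemma left_sweep_start:
  assumes r0: "r 0 = 1" and l: "DEIM (U_le n r U 1) l" "I 1 = map (\<lambda>p. [p]) l"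
    and I0: "I 0 = [[]]"
  shows "trivial_kernel (M_mat n r U I 0)"
    and "DEIM (U_hat n r U I 1) l" and "I 1 = map (extend_le r I 1) l"
proof -
  have "M_mat n r U I 0 = 1\<^sub>m 1"
    by (rule eq_matI) (auto simp: M_mat_def rows_le_def U_le_def r0 I0 left_modes_def)
  then show "trivial_kernel (M_mat n r U I 0)" by (simp add: trivial_kernel_one_mat)
  have "U_hat n r U I 1 = U_le n r U 1"
    by (rule eq_matI) (auto simp: U_hat_def U_le_def extend_le_def r0 I0 left_modes_def)
  then show "DEIM (U_hat n r U I 1) l" using l(1) by simp
  show "I 1 = map (extend_le r I 1) l" using l(2) by (simp add: extend_le_def r0 I0)
qed

lemma right_sweep_start:
  assumes d: "0 < d" and rd: "r d = 1"
    and l: "DEIM (V_gt d n r V (d - 1)) l" "J (d - 1) = map (\<lambda>p. [p]) l"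
    and Jd: "J d = [[]]"
  shows "trivial_kernel (N_mat d n r V J d)"
    and "DEIM (V_hat d n r V J (d - 1)) l" and "J (d - 1) = map (extend_gt n J (d - 1)) l"
proof -
  obtain e where e: "d = Suc e" using d by (cases d) auto
  have "N_mat d n r V J d = 1\<^sub>m 1"
    by (rule eq_matI) (auto simp: N_mat_def rows_gt_def V_gt_def rd Jd right_modes_def)
  then show "trivial_kernel (N_mat d n r V J d)" by (simp add: trivial_kernel_one_mat)
  have modes: "right_modes (Suc e) n e = [n (Suc e)]" by (simp add: right_modes_def)
  have "V_hat d n r V J (d - 1) = V_gt d n r V (d - 1)"
    using rd Jd unfolding e
    by (intro eq_matI) (auto simp: V_hat_def V_gt_def extend_gt_def modes)
  then show "DEIM (V_hat d n r V J (d - 1)) l" using l(1) by simp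
  \<comment> \<open>The bound gives \<open>p mod n d = p\<close> and \<open>p div n d = 0\<close>,
    so \<open>extend_gt\<close> puts \<open>p\<close> in front of the empty multi-index.\<close>
  have "p < n d" if "p \<in> set l" for p
    using DEIM_less[OF l(1) that] by (simp add: V_gt_def modes e)
  then show "J (d - 1) = map (extend_gt n J (d - 1)) l"
    using l(2) Jd unfolding e by (auto simp: extend_gt_def)
qed

text \<open>Induction starting at bond 0, where the selected matrix is the 1 by 1 identity. The
  sweep treats its first step separately, hence the case distinction.\<close>

lemma left_sweep_trivial_kernel:
  assumes core: "\<forall>k\<in>{1..d - 1}. left_orthogonal_core (r (k - 1)) (n k) (r k) (U k)"
    and r0: "r 0 = 1" and sweep: "left_to_right_sweep d n r U I" and I0: "I 0 = [[]]"
    and "j \<le> d - 1"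
  shows "length (I j) = r j \<and> set (I j) \<subseteq> multi_indices (left_modes n j) \<and>
    trivial_kernel (M_mat n r U I j)"
proof -
  obtain l1 where l: "DEIM (U_le n r U 1) l1" "I 1 = map (\<lambda>p. [p]) l1"
    using sweep unfolding left_to_right_sweep_def by blast
  show ?thesis
    using \<open>j \<le> d - 1\<close>
  proof (induction j)
    case 0
    show ?case
      using left_sweep_start(1)[OF r0 l I0]
      by (simp add: r0 I0 left_modes_def multi_indices_def)
  next
    case (Suc j)
    obtain l where "DEIM (U_hat n r U I (Suc j)) l" "I (Suc j) = map (extend_le r I (Suc j)) l"
    proof (cases "j = 0")
      case True
      then show ?thesis using left_sweep_start(2,3)[OF r0 l I0] that by simp
    next
      case False
      then have "Suc j \<in> {2..d - 1}" using Suc.prems by simp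
      then show ?thesis using sweep that unfolding left_to_right_sweep_def by blast
    qed
    then show ?case using left_sweep_step[of j r n U I l] core r0 Suc by auto
  qed
qed

text \<open>Downward induction from bond \<open>d\<close>; it stops at bond 1, where the sweep
  ends.\<close>

lemma right_sweep_trivial_kernel:
  assumes core: "\<forall>k\<in>{2..d}. right_orthogonal_core (r (k - 1)) (n k) (r k) (V k)"
    and d: "2 \<le> d"
    and rd: "r d = 1" and sweep: "right_to_left_sweep d n r V J" and Jd: "J d = [[]]"
    and "j \<le> d" "1 \<le> j"
  shows "length (J j) = r j \<and> set (J j) \<subseteq> multi_indices (right_modes d n j) \<and>
    trivial_kernel (N_mat d n r V J j)"
proof -
  obtain l1 where l: "DEIM (V_gt d n r V (d - 1)) l1" "J (d - 1) = map (\<lambda>p. [p]) l1"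
    using sweep unfolding right_to_left_sweep_def by blast
  have d0: "0 < d" using d by simp
  show ?thesis
    using assms(6,7)
  proof (induction j rule: inc_induct)
    case base
    show ?case
      using right_sweep_start(1)[OF d0 rd l Jd]
      by (simp add: rd Jd right_modes_def multi_indices_def)
  next
    case (step j)
    obtain l where "DEIM (V_hat d n r V J j) l" "J j = map (extend_gt n J j) l"
    proof (cases "j = d - 1")
      case True
      then show ?thesis using right_sweep_start(2,3)[OF d0 rd l Jd] that by simp
    next
      case False
      then have "j \<in> {1..d - 2}" using step.hyps step.prems by auto
      then show ?thesis using sweep that unfolding right_to_left_sweep_def by blast
    qed
    then show ?case using right_sweep_step[of j d r n V J l] core rd step by auto
  qed
qed

theorem theorem5p1:
  fixes d :: nat
    and n r :: "nat \<Rightarrow> nat"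
    and Y :: tensor
    and U V :: "nat \<Rightarrow> core"
    and I J :: "nat \<Rightarrow> nat list list"
  assumes "d \<ge> 2"
    and "\<forall>k\<in>{1..d}. n k \<ge> 1"
    and "Y \<in> tt_manifold d n r"
    and "orthogonal_tt_decomposition d n r Y U V"
    and "left_to_right_sweep d n r U I"
    and "right_to_left_sweep d n r V J"
  shows "\<forall>j\<in>{1..d - 1}. invertible_mat (M_mat n r U I j) \<and> invertible_mat (N_mat d n r V J j)"
proof
  fix j assume j: "j \<in> {1..d - 1}"
  then have jd: "j \<noteq> d" using assms(1) by auto
  \<comment> \<open>The boundary ranks are 1 by the convention built into
    \<open>tt_rank\<close>.\<close>
  have "r 0 = tt_rank d n Y 0" "r d = tt_rank d n Y d"
    using assms(3) by (auto simp: tt_manifold_def)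
  then have r: "r 0 = 1" "r d = 1" by (simp_all add: tt_rank_def)
  \<comment> \<open>The sweeps leave \<open>I 0\<close> and \<open>J d\<close> arbitrary, so both
    are overwritten by the list holding only the empty multi-index.\<close>
  define I' where "I' = I(0 := [[]])"
  define J' where "J' = J(d := [[]])"
  \<comment> \<open>At bond \<open>k\<close> only the list at \<open>k - 1\<close> is read, and
    \<open>k - 1\<close> is positive, so the overwritten entry is never seen.\<close>
  have hat: "U_hat n r U I' k = U_hat n r U I k" "extend_le r I' k = extend_le r I k"
    if "k \<in> {2..d - 1}" for k
    using that by (auto simp: I'_def U_hat_def extend_le_def fun_eq_iff)
  then have "left_to_right_sweep d n r U I'"
    using assms(5) by (auto simp: left_to_right_sweep_def I'_def)
  then have "trivial_kernel (M_mat n r U I' j)"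
    using left_sweep_trivial_kernel[of d r n U I' j] assms(4) r j
    by (auto simp: orthogonal_tt_decomposition_def I'_def)
  then have M: "trivial_kernel (M_mat n r U I j)"
    using j by (simp add: M_mat_def rows_le_def I'_def)
  \<comment> \<open>Likewise the list at \<open>k + 1\<close> is read, and \<open>k + 1\<close>
    stays below \<open>d\<close>.\<close>
  have hat': "V_hat d n r V J' k = V_hat d n r V J k" "extend_gt n J' k = extend_gt n J k"
    if "k \<in> {1..d - 2}" for k
    using that by (auto simp: J'_def V_hat_def extend_gt_def fun_eq_iff)
  then have "right_to_left_sweep d n r V J'"
    using assms(1,6) by (auto simp: right_to_left_sweep_def J'_def)
  then have "trivial_kernel (N_mat d n r V J' j)"
    using right_sweep_trivial_kernel[of d r n V J' j] assms(1,4) r j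
    by (auto simp: orthogonal_tt_decomposition_def J'_def)
  then have N: "trivial_kernel (N_mat d n r V J j)"
    using jd by (simp add: N_mat_def rows_gt_def J'_def)
  show "invertible_mat (M_mat n r U I j) \<and> invertible_mat (N_mat d n r V J j)"
    using trivial_kernel_invertible[OF _ M, of "r j"] trivial_kernel_invertible[OF _ N, of "r j"]
    by (simp add: M_mat_def N_mat_def)
qed

end
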